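(* Let $d\ge1$ and let $A\in GL_d(\mathbb{Q})$ be non-hyperbolic (that is, $A$ has a complex eigenvalue of modulus $1$) and $\mathbb{Q}$-irreducible. Then $G:=\mathbb{Z}\ltimes_A\mathbb{Q}^d$ admits a faithful action by orientation-preserving $C^1$ diffeomorphisms of the closed interval $[0,1]$ that is not semiconjugate to an affine action though it has no global fixed point in $(0,1)$.
   Context: $\mathbb{Z}\ltimes_A\mathbb{Q}^d$ is the semidirect product in which the generator $a$ of $\mathbb{Z}$ acts on $\mathbb{Q}^d$ by $a\,b\,a^{-1}=A(b)$. $A$ is $\mathbb{Q}$-irreducible if it preserves no proper nonzero $\mathbb{Q}$-linear subspace of $\mathbb{Q}^d$. A global fixed point is a point fixed by all elements of $G$. An action of $G$ on $[0,1]$ is semiconjugate to an affine one if there exist a homomorphism $\psi:G\to\mathrm{Aff}_+(\mathbb{R})$ and a continuous, non-decreasing, surjective map $F:(0,1)\to\mathbb{R}$ with $F(g(x))=\psi(g)(F(x))$ for all $g\in G$, $x\in(0,1)$; $\mathrm{Aff}_+(\mathbb{R})$ is the group of maps $x\mapsto\lambda x+t$ with $\lambda>0$, $t\in\mathbb{R}$. *)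

theory Defs
  imports "HOL-Analysis.Analysis" "HOL-Algebra.Group_Action"
begin

definition matrix_eigenvalue :: "'a::field ^ 'n ^ 'n \<Rightarrow> 'a \<Rightarrow> bool" where
  "matrix_eigenvalue M c \<longleftrightarrow> (\<exists>v. v \<noteq> 0 \<and> M *v v = c *s v)"

definition non_hyperbolic :: "rat ^ 'n ^ 'n \<Rightarrow> bool" where
  "non_hyperbolic A \<longleftrightarrow>
     (\<exists>c::complex. matrix_eigenvalue (map_matrix of_rat A) c \<and> cmod c = 1)"

definition Q_irreducible :: "rat ^ 'n ^ 'n \<Rightarrow> bool" where
  "Q_irreducible A \<longleftrightarrow>
     (\<forall>S. vec.subspace S \<and> (*v) A ` S \<subseteq> S \<longrightarrow> S = {0} \<or> S = UNIV)"

definition mat_int_act :: "rat ^ 'n ^ 'n \<Rightarrow> int \<Rightarrow> rat ^ 'n \<Rightarrow> rat ^ 'n" where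
  "mat_int_act A k =
     (if k \<ge> 0 then (*v) A ^^ nat k else (*v) (matrix_inv A) ^^ nat (- k))"

text \<open>The pair \<open>(k, v)\<close> stands for the element \<open>v a\<^sup>k\<close>, where \<open>a\<close> is the generator of the
  integers, so that \<open>(v a\<^sup>k) (w a\<^sup>l) = (v + A\<^sup>k w) a\<^sup>k\<^sup>+\<^sup>l\<close>.  This is a group only for
  invertible \<open>A\<close>.\<close>

definition Z_semidirect :: "rat ^ 'n ^ 'n \<Rightarrow> (int \<times> (rat ^ 'n)) monoid" where
  "Z_semidirect A =
     \<lparr>carrier = UNIV,
      mult = (\<lambda>(k, v) (l, w). (k + l, v + mat_int_act A k w)),
      one = (0, 0)\<rparr>"

text \<open>Differentiability is one-sided at the endpoints; the values of \<open>f\<close> outside \<open>[0, 1]\<close> are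
  irrelevant.\<close>

definition C1_on_unit :: "(real \<Rightarrow> real) \<Rightarrow> bool" where
  "C1_on_unit f \<longleftrightarrow>
     (\<exists>f'. (\<forall>x\<in>{0..1}. (f has_real_derivative f' x) (at x within {0..1})) \<and>
           continuous_on {0..1} f')"

definition C1_diffeo_plus :: "(real \<Rightarrow> real) \<Rightarrow> bool" where
  "C1_diffeo_plus f \<longleftrightarrow>
     bij_betw f {0..1} {0..1} \<and> strict_mono_on {0..1} f \<and>
     C1_on_unit f \<and> C1_on_unit (inv_into {0..1} f)"

definition Aff_plus :: "(real \<Rightarrow> real) monoid" where
  "Aff_plus =
     \<lparr>carrier = {h. \<exists>l t. l > 0 \<and> h = (\<lambda>x. l * x + t)}, mult = (\<circ>), one = id\<rparr>"

definition semiconjugate_to_affine :: "('g, 'm) monoid_scheme \<Rightarrow> ('g \<Rightarrow> real \<Rightarrow> real) \<Rightarrow> bool" where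
  "semiconjugate_to_affine G \<rho> \<longleftrightarrow>
     (\<exists>\<psi> F. \<psi> \<in> hom G Aff_plus \<and>
        continuous_on {0<..<1} F \<and> mono_on {0<..<1} F \<and> F ` {0<..<1} = (UNIV :: real set) \<and>
        (\<forall>g\<in>carrier G. \<forall>x\<in>{0<..<1}. F (\<rho> g x) = \<psi> g (F x)))"

definition global_fixed_point :: "('g, 'm) monoid_scheme \<Rightarrow> ('g \<Rightarrow> 'x \<Rightarrow> 'x) \<Rightarrow> 'x \<Rightarrow> bool" where
  "global_fixed_point G \<rho> x \<longleftrightarrow> (\<forall>g\<in>carrier G. \<rho> g x = x)"

lemma mat_int_act_0 [simp]: "mat_int_act A 0 v = v"
  by (simp add: mat_int_act_def)

lemma mat_int_act_1 [simp]: "mat_int_act A 1 v = A *v v"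
  by (simp add: mat_int_act_def)

lemma matrix_inv_both:
  fixes A :: "rat ^ 'n ^ 'n"
  assumes "invertible A"
  shows "A ** matrix_inv A = mat 1 \<and> matrix_inv A ** A = mat 1"
  using assms unfolding invertible_def matrix_inv_def by (rule someI_ex)

lemma mat_int_act_Suc:
  assumes "invertible A"
  shows "mat_int_act A (k + 1) v = A *v mat_int_act A k v"
proof (cases "k \<ge> 0")
  case True
  then have "nat (k + 1) = Suc (nat k)" by simp
  with True show ?thesis by (simp add: mat_int_act_def)
next
  case False
  then have e: "nat (- k) = Suc (nat (- (k + 1)))" by simp
  have "A *v (matrix_inv A *v w) = w" for w
    by (simp add: matrix_vector_mul_assoc matrix_inv_both[OF assms])
  with False show ?thesis
    by (cases "k = -1") (auto simp: mat_int_act_def e simp del: minus_add_distrib)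
qed

lemma mat_int_act_pred:
  assumes "invertible A"
  shows "mat_int_act A (k - 1) v = matrix_inv A *v mat_int_act A k v"
proof -
  have "mat_int_act A k v = A *v mat_int_act A (k - 1) v"
    using mat_int_act_Suc[OF assms, of "k - 1" v] by simp
  then show ?thesis
    by (simp add: matrix_vector_mul_assoc matrix_inv_both[OF assms])
qed

lemma mat_int_act_add_int:
  assumes "invertible A"
  shows "mat_int_act A (k + l) v = mat_int_act A k (mat_int_act A l v)"
proof (induction k rule: int_induct[where k = 0])
  case (step1 i)
  have "mat_int_act A (i + 1 + l) v = A *v mat_int_act A (i + l) v"
    using mat_int_act_Suc[OF assms, of "i + l" v] by (simp add: algebra_simps)
  with step1 show ?case by (simp add: mat_int_act_Suc[OF assms])
next
  case (step2 i)
  have "mat_int_act A (i - 1 + l) v = matrix_inv A *v mat_int_act A (i + l) v"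
    using mat_int_act_pred[OF assms, of "i + l" v] by (simp add: algebra_simps)
  with step2 show ?case by (simp add: mat_int_act_pred[OF assms])
qed simp

lemma mat_int_act_add_vec:
  assumes "invertible A"
  shows "mat_int_act A k (v + w) = mat_int_act A k v + mat_int_act A k w"
  by (induction k rule: int_induct[where k = 0])
    (simp_all add: mat_int_act_Suc[OF assms] mat_int_act_pred[OF assms]
      matrix_vector_right_distrib)

lemma group_Z_semidirect:
  assumes "invertible A"
  shows "group (Z_semidirect A)"
proof (rule groupI)
  fix x assume "x \<in> carrier (Z_semidirect A)"
  obtain k v where x: "x = (k, v)" by fastforce
  show "\<exists>y\<in>carrier (Z_semidirect A). y \<otimes>\<^bsub>Z_semidirect A\<^esub> x = \<one>\<^bsub>Z_semidirect A\<^esub>"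
    by (rule bexI[where x = "(- k, - mat_int_act A (- k) v)"]) (simp_all add: Z_semidirect_def x)
qed (auto simp: Z_semidirect_def mat_int_act_add_int[OF assms] mat_int_act_add_vec[OF assms])

lemma Z_semidirect_conj:
  assumes "invertible A"
  shows "(1, 0) \<otimes>\<^bsub>Z_semidirect A\<^esub> (0, v) \<otimes>\<^bsub>Z_semidirect A\<^esub> inv\<^bsub>Z_semidirect A\<^esub> (1, 0) = (0, A *v v)"
proof -
  interpret group "Z_semidirect A" by (rule group_Z_semidirect[OF assms])
  have z: "mat_int_act A k 0 = 0" for k
    using mat_int_act_add_vec[OF assms, of k 0 0] by simp
  have "inv\<^bsub>Z_semidirect A\<^esub> (1, 0) = (- 1, 0)"
    by (rule inv_equality) (simp_all add: Z_semidirect_def z)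
  then show ?thesis by (simp add: Z_semidirect_def z)
qed

lemma group_Aff_plus: "group Aff_plus"
proof (rule groupI)
  fix h assume "h \<in> carrier Aff_plus"
  then obtain l t where h: "l > 0" "h = (\<lambda>x. l * x + t)" by (auto simp: Aff_plus_def)
  define h' where "h' = (\<lambda>x. (1 / l) * x + (- t / l))"
  have "h' \<in> carrier Aff_plus"
    unfolding Aff_plus_def partial_object.simps mem_Collect_eq
    by (rule exI[of _ "1 / l"], rule exI[of _ "- t / l"]) (simp add: h'_def h(1))
  moreover have "h' \<circ> h = id"
    using h by (auto simp: h'_def fun_eq_iff field_simps)
  ultimately show "\<exists>y\<in>carrier Aff_plus. y \<otimes>\<^bsub>Aff_plus\<^esub> h = \<one>\<^bsub>Aff_plus\<^esub>"
    by (auto simp: Aff_plus_def)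
next
  fix g h assume "g \<in> carrier Aff_plus" "h \<in> carrier Aff_plus"
  then obtain l t m s where "l > 0" "g = (\<lambda>x. l * x + t)" "m > 0" "h = (\<lambda>x. m * x + s)"
    by (auto simp: Aff_plus_def)
  then have "l * m > 0" "g \<circ> h = (\<lambda>x. (l * m) * x + (l * s + t))"
    by (auto simp: fun_eq_iff algebra_simps)
  then show "g \<otimes>\<^bsub>Aff_plus\<^esub> h \<in> carrier Aff_plus"
    unfolding Aff_plus_def by auto
next
  show "\<one>\<^bsub>Aff_plus\<^esub> \<in> carrier Aff_plus"
    unfolding Aff_plus_def partial_object.simps mem_Collect_eq
    by (rule exI[of _ 1], rule exI[of _ 0]) (simp add: fun_eq_iff)
qed (auto simp: Aff_plus_def)

end

theory Submission
  imports Defs "HOL-Real_Asymp.Real_Asymp"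
begin

text \<open>
  Cut (0,1) into open intervals indexed by the integers and parametrise the \<open>k\<close>-th one by a real
  \<open>s\<close>. The generator \<open>a\<close> sends the point with coordinates \<open>(k, s)\<close> to \<open>(k + 1, s)\<close>, and a vector
  \<open>v\<close> sends it to \<open>(k, s + Re (c\<^sup>-\<^sup>k f(v)))\<close>, where \<open>f\<close> is a linear form that is a left eigenvector
  of \<open>A\<close> for an eigenvalue \<open>c\<close> of modulus 1. Irreducibility makes this faithful. Since \<open>|c| = 1\<close>,
  a fixed group element moves \<open>(k, s)\<close> by a bounded amount. The parametrisation has speed
  \<open>1 / (4 R\<^sup>3)\<close>, where \<open>R\<close> grows like the norm of \<open>(k, s)\<close>, so the derivative of a group element is
  a cubed ratio of two values of \<open>R\<close> at bounded distance from each other. It therefore tends to 1 at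
  the endpoints of the intervals and at 0 and 1, which gives the \<open>C\<^sup>1\<close> property. Vectors fix the
  endpoints of the intervals, which excludes a semiconjugacy to an affine action.
\<close>

section \<open>The partition of the unit interval\<close>

text \<open>The gaps of this homeomorphism onto (0,1) between consecutive integers decay
  quadratically, which allows \<open>depth\<close>, whose inverse square they are up to a factor, to
  grow linearly.\<close>

definition cpos :: "real \<Rightarrow> real" where
  "cpos r = 1/2 + r / (2 * (1 + \<bar>r\<bar>))"

abbreviation node :: "int \<Rightarrow> real" where
  "node k \<equiv> cpos (of_int k)"

definition depth :: "int \<Rightarrow> real" where
  "depth k = sqrt (if k \<ge> 0 then (of_int k + 1) * (of_int k + 2) else of_int k * (of_int k - 1))"

definition rad :: "int \<Rightarrow> real \<Rightarrow> real" where
  "rad k s = sqrt ((depth k)\<^sup>2 + s\<^sup>2)"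

text \<open>\<open>pt (k, None)\<close> is the left endpoint of the \<open>k\<close>-th interval. The depth is chosen such that the
  length of this interval is the integral of \<open>1 / (4 R\<^sup>3)\<close> over the real line, where
  \<open>R = rad k s\<close>.\<close>

fun pt :: "int \<times> real option \<Rightarrow> real" where
  "pt (k, None) = node k"
| "pt (k, Some s) = node k + (node (k + 1) - node k) / 2 * (1 + s / rad k s)"

lemma cpos_strict_mono: "strict_mono cpos"
proof (rule strict_monoI)
  fix r s :: real
  assume "r < s"
  consider "0 \<le> r" | "r < 0" "0 \<le> s" | "s < 0" using \<open>r < s\<close> by linarith
  then show "cpos r < cpos s"
  proof cases
    case 1
    then show ?thesis using \<open>r < s\<close> by (simp add: cpos_def field_simps)
  next
    case 2
    then have "r / (2 * (1 + \<bar>r\<bar>)) < 0" "0 \<le> s / (2 * (1 + \<bar>s\<bar>))"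
      by (auto simp: divide_less_0_iff)
    then show ?thesis by (simp add: cpos_def)
  next
    case 3
    then show ?thesis using \<open>r < s\<close> by (simp add: cpos_def field_simps)
  qed
qed

lemma cpos_bounds: "0 < cpos r" "cpos r < 1"
  by (auto simp: cpos_def field_simps abs_if)

lemma cpos_surj:
  assumes "0 < x" "x < 1"
  obtains r where "cpos r = x"
proof
  \<comment> \<open>Rescaled to (-1,1), \<open>cpos\<close> is r/(1 + |r|), whose inverse is y/(1 -
    |y|).\<close>
  define y where "y = 2 * x - 1"
  have y: "\<bar>y\<bar> < 1" using assms by (auto simp: y_def abs_if)
  have "\<bar>y / (1 - \<bar>y\<bar>)\<bar> = \<bar>y\<bar> / (1 - \<bar>y\<bar>)" using y by (simp add: abs_divide)
  then have "1 + \<bar>y / (1 - \<bar>y\<bar>)\<bar> = 1 / (1 - \<bar>y\<bar>)" using y by (simp add: field_simps)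
  then have "cpos (y / (1 - \<bar>y\<bar>)) = 1/2 + y/2" using y by (simp add: cpos_def)
  then show "cpos (y / (1 - \<bar>y\<bar>)) = x" by (simp add: y_def field_simps)
qed

lemma node_less_iff [simp]: "node j < node k \<longleftrightarrow> j < k"
  and node_le_iff [simp]: "node j \<le> node k \<longleftrightarrow> j \<le> k"
  and node_eq_iff [simp]: "node j = node k \<longleftrightarrow> j = k"
  using cpos_strict_mono
  by (simp_all add: strict_mono_less strict_mono_less_eq strict_mono_eq)

lemma node_succ [simp]: "node k < cpos (of_int k + 1)"
  using node_less_iff[of k "k + 1"] by simp

lemma depth_radicand_pos:
  "0 < (if k \<ge> 0 then (of_int k + 1) * (of_int k + 2) else of_int k * (of_int k - 1) :: real)"
  by (auto intro!: mult_neg_neg)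

lemma depth_pos: "0 < depth k"
  using depth_radicand_pos[of k] by (simp add: depth_def)

lemma depth_bounds: "\<bar>of_int k\<bar> \<le> depth k" "depth k \<le> \<bar>of_int k\<bar> + 2"
proof -
  show "\<bar>of_int k\<bar> \<le> depth k"
    unfolding depth_def
    by (rule real_le_rsqrt) (auto simp: power2_eq_square algebra_simps)
  show "depth k \<le> \<bar>of_int k\<bar> + 2"
    unfolding depth_def
    by (rule real_le_lsqrt) (auto simp: power2_eq_square algebra_simps)
qed

text \<open>In both cases the radicand of \<open>depth\<close> is (1 + |k|)(1 + |k + 1|), the
  product of the denominators of r/(1 + |r|) at \<open>k\<close> and \<open>k + 1\<close>; over this
  common denominator the numerator of the difference is 1.\<close>

lemma node_gap: "node (k + 1) - node k = 1 / (2 * (depth k)\<^sup>2)"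
proof (cases "k \<ge> 0")
  case True
  have "1/2 + (x + 1) / (2 * (2 + x)) - (1/2 + x / (2 * (1 + x))) = 1 / (2 * ((x + 1) * (x + 2)))"
    if "x \<ge> 0" for x :: real
    using that by (simp add: divide_simps) (simp add: algebra_simps)
  from this[of "of_int k"] True show ?thesis
    by (simp add: depth_def cpos_def add.commute)
next
  case False
  define m :: real where "m = - of_int k"
  have "k \<le> -1" using False by simp
  then have "real_of_int k \<le> -1" by linarith
  then have "m \<ge> 1" by (simp add: m_def)
  have k: "real_of_int k = - m" by (simp add: m_def)
  have "1 - m \<le> 0" using \<open>m \<ge> 1\<close> by simp
  then show ?thesis
    using depth_radicand_pos[of k] False \<open>m \<ge> 1\<close>
    by (simp add: depth_def cpos_def k) (simp add: field_simps)
qed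

section \<open>The parametrisation of a single interval: speed, range and limits\<close>

lemma rad_pos: "0 < rad k s"
  using depth_pos[of k] by (simp add: rad_def add_pos_nonneg)

lemma rad_nonzero [simp]: "rad k s \<noteq> 0"
  using rad_pos[of k s] by simp

lemma abs_less_rad: "\<bar>s\<bar> < rad k s"
  using depth_pos[of k] unfolding rad_def by (intro real_less_rsqrt) simp

text \<open>The radius is the Euclidean norm of (depth k, s), and the depth is Lipschitz up to
  an additive constant.\<close>

lemma rad_shift: "\<bar>rad (k + n) (s + t) - rad k s\<bar> \<le> \<bar>of_int n\<bar> + 2 + \<bar>t\<bar>"
proof -
  have rad: "rad j u = norm (Complex (depth j) u)" for j u
    by (simp add: rad_def complex_norm)
  have "\<bar>rad (k + n) (s + t) - rad k s\<bar>
      \<le> norm (Complex (depth (k + n)) (s + t) - Complex (depth k) s)"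
    unfolding rad by (rule norm_triangle_ineq3)
  also have "\<dots> = norm (Complex (depth (k + n) - depth k) t)"
    by (simp add: complex_diff)
  also have "\<dots> \<le> \<bar>depth (k + n) - depth k\<bar> + \<bar>t\<bar>"
    using cmod_le[of "Complex (depth (k + n) - depth k) t"] by simp
  also have "\<bar>depth (k + n) - depth k\<bar> \<le> \<bar>of_int n\<bar> + 2"
    using depth_bounds[of k] depth_bounds[of "k + n"] by auto
  finally show ?thesis by simp
qed

text \<open>The quotient rule leaves the square of the depth over the cubed radius, and half of
  \<open>node_gap\<close> cancels that square. The speed thus depends on \<open>k\<close> and
  \<open>s\<close> through the radius only, with one constant for all intervals.\<close>

lemma pt_deriv:
  "((\<lambda>s. pt (k, Some s)) has_real_derivative 1 / (4 * rad k s ^ 3)) (at s)"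
proof -
  have p: "0 < (depth k)\<^sup>2 + s\<^sup>2" using depth_pos[of k] by (simp add: add_pos_nonneg)
  have sq: "(rad k s)\<^sup>2 = (depth k)\<^sup>2 + s\<^sup>2" using p by (simp add: rad_def)
  have "(rad k has_real_derivative s / rad k s) (at s)"
    unfolding rad_def[abs_def] using p
    by (auto intro!: derivative_eq_intros simp: field_simps)
  then have "((\<lambda>s. pt (k, Some s)) has_real_derivative
      (node (k + 1) - node k) / 2 * ((rad k s - s * (s / rad k s)) / (rad k s * rad k s))) (at s)"
    unfolding pt.simps by (auto intro!: derivative_eq_intros)
  moreover have "(rad k s - s * (s / rad k s)) / (rad k s * rad k s)
      = ((rad k s)\<^sup>2 - s\<^sup>2) / rad k s ^ 3"
    using rad_pos[of k s] by (simp add: field_simps power2_eq_square power3_eq_cube)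
  moreover have "(node (k + 1) - node k) / 2 * (((rad k s)\<^sup>2 - s\<^sup>2) / rad k s ^ 3)
      = 1 / (4 * rad k s ^ 3)"
    unfolding node_gap sq using depth_pos[of k] by simp
  ultimately show ?thesis by (simp only:)
qed

lemma pt_continuous: "continuous_on A (\<lambda>s. pt (k, Some s))"
  by (rule DERIV_continuous_on) (rule has_field_derivative_at_within[OF pt_deriv])

lemma pt_Some_strict_mono: "s < t \<Longrightarrow> pt (k, Some s) < pt (k, Some t)"
  using DERIV_pos_imp_increasing[of s t "\<lambda>s. pt (k, Some s)"] pt_deriv[of k] rad_pos[of k]
  by (meson zero_less_divide_1_iff zero_less_mult_iff zero_less_numeral zero_less_power)

lemma pt_Some_bounds: "node k < pt (k, Some s)" "pt (k, Some s) < node (k + 1)"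
proof -
  have "\<bar>s / rad k s\<bar> < 1"
    using abs_less_rad[of s k] rad_pos[of k s] by (simp add: abs_divide)
  then have *: "0 < 1 + s / rad k s" "1 + s / rad k s < 2" by linarith+
  have g: "0 < node (k + 1) - node k" by simp
  define w where "w = (node (k + 1) - node k) / 2 * (1 + s / rad k s)"
  have "0 < w"
    unfolding w_def using * g by (intro mult_pos_pos) simp_all
  have "w < (node (k + 1) - node k) / 2 * 2"
    unfolding w_def using * g by (intro mult_strict_left_mono) simp_all
  then have "w < node (k + 1) - node k" by simp
  moreover have "pt (k, Some s) = node k + w" by (simp only: pt.simps w_def)
  ultimately show "node k < pt (k, Some s)" "pt (k, Some s) < node (k + 1)"
    using \<open>0 < w\<close> by linarith+
qed

declare pt.simps(2) [simp del]

lemma pt_Some_surj: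
  assumes "node k < x" "x < node (k + 1)"
  obtains s where "pt (k, Some s) = x"
proof
  define g where "g = node (k + 1) - node k"
  define y where "y = 2 * (x - node k) / g - 1"
  have g: "g > 0" by (simp add: g_def)
  have y: "\<bar>y\<bar> < 1" using assms g by (auto simp: y_def g_def abs_if field_simps)
  then have y2: "0 < 1 - y\<^sup>2" by (simp add: abs_square_less_1)
  \<comment> \<open>The solution of \<open>s / rad k s = y\<close>.\<close>
  define s where "s = depth k * y / sqrt (1 - y\<^sup>2)"
  have "(depth k)\<^sup>2 + s\<^sup>2 = (depth k)\<^sup>2 / (1 - y\<^sup>2)"
    using y2 by (simp add: s_def power_divide power_mult_distrib field_simps)
  then have "rad k s = depth k / sqrt (1 - y\<^sup>2)"
    using depth_pos[of k] by (simp add: rad_def real_sqrt_divide)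
  then have "s / rad k s = y" using y2 depth_pos[of k] by (simp add: s_def)
  then have "pt (k, Some s) = node k + g / 2 * (1 + y)" by (simp add: pt.simps g_def)
  also have "\<dots> = x" using g by (simp add: y_def field_simps)
  finally show "pt (k, Some s) = x" .
qed

lemma pt_tendsto_top: "((\<lambda>s. pt (k, Some s)) \<longlongrightarrow> node (k + 1)) at_top"
  and pt_tendsto_bot: "((\<lambda>s. pt (k, Some s)) \<longlongrightarrow> node k) at_bot"
proof -
  have "((\<lambda>s. s / sqrt (a\<^sup>2 + s\<^sup>2)) \<longlongrightarrow> 1) at_top" if "a > 0" for a :: real
    using that by real_asymp
  from this[OF depth_pos]
  have "((\<lambda>s. pt (k, Some s)) \<longlongrightarrow> node k + (node (k + 1) - node k) / 2 * (1 + 1)) at_top"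
    unfolding rad_def pt.simps by (intro tendsto_intros)
  then show "((\<lambda>s. pt (k, Some s)) \<longlongrightarrow> node (k + 1)) at_top"
    by (rule tendsto_eq_rhs) (simp add: field_simps)
  have "((\<lambda>s. s / sqrt (a\<^sup>2 + s\<^sup>2)) \<longlongrightarrow> -1) at_bot" if "a > 0" for a :: real
    using that by real_asymp
  from this[OF depth_pos]
  have "((\<lambda>s. pt (k, Some s)) \<longlongrightarrow> node k + (node (k + 1) - node k) / 2 * (1 + -1)) at_bot"
    unfolding rad_def pt.simps by (intro tendsto_intros)
  then show "((\<lambda>s. pt (k, Some s)) \<longlongrightarrow> node k) at_bot"
    by simp
qed

section \<open>The lexicographic order on coordinates, with \<open>None\<close> first\<close>

fun pt_less :: "int \<times> real option \<Rightarrow> int \<times> real option \<Rightarrow> bool" where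
  "pt_less (j, a) (k, b) \<longleftrightarrow> j < k \<or>
     j = k \<and> (case b of None \<Rightarrow> False | Some t \<Rightarrow> (case a of None \<Rightarrow> True | Some s \<Rightarrow> s < t))"

lemma pt_bounds: "node k \<le> pt (k, a)" "pt (k, a) < node (k + 1)"
  using pt_Some_bounds[of k] by (cases a; force simp: less_imp_le)+

lemma pt_less_imp: "pt_less x y \<Longrightarrow> pt x < pt y"
proof (cases x; cases y)
  fix j a k b
  assume "pt_less x y" and xy: "x = (j, a)" "y = (k, b)"
  then consider "j < k" | t where "j = k" "a = None" "b = Some t"
    | s t where "j = k" "a = Some s" "b = Some t" "s < t"
    by (auto split: option.splits)
  then show ?thesis
  proof cases
    case 1
    then have "pt (j, a) < node (j + 1)" "node (j + 1) \<le> node k" "node k \<le> pt (k, b)"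
      by (auto intro: pt_bounds simp del: of_int_add)
    then show ?thesis by (simp add: xy)
  next
    case 2
    then show ?thesis using pt_Some_bounds by (simp add: xy)
  next
    case 3
    then show ?thesis using pt_Some_strict_mono by (simp add: xy)
  qed
qed

lemma pt_less_total: "x = y \<or> pt_less x y \<or> pt_less y x"
  by (cases x; cases y) (auto split: option.splits)

lemma pt_less_iff: "pt x < pt y \<longleftrightarrow> pt_less x y"
  using pt_less_imp[of x y] pt_less_imp[of y x] pt_less_total[of x y] by fastforce

lemma inj_pt: "inj pt"
  by (rule injI) (metis order_less_irrefl pt_less_iff pt_less_total)

lemma pt_in_unit: "0 < pt z" "pt z < 1"
proof -
  obtain k a where z: "z = (k, a)" by fastforce
  show "0 < pt z" "pt z < 1"
    using pt_bounds[of k a] cpos_bounds(1)[of "of_int k"] cpos_bounds(2)[of "of_int (k + 1)"]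
    unfolding z by linarith+
qed

lemma pt_surj:
  assumes "0 < x" "x < 1"
  obtains z where "pt z = x"
proof -
  obtain r where r: "cpos r = x" using cpos_surj[OF assms] .
  \<comment> \<open>The floor selects the half-open interval that contains \<open>x\<close>; if
    \<open>x\<close> is its left endpoint, the coordinate is \<open>None\<close>.\<close>
  have "node \<lfloor>r\<rfloor> \<le> x" "x < node (\<lfloor>r\<rfloor> + 1)"
    unfolding r[symmetric] using cpos_strict_mono
    by (simp_all add: strict_mono_less strict_mono_less_eq del: of_int_add) linarith
  then consider "pt (\<lfloor>r\<rfloor>, None) = x" | s where "pt (\<lfloor>r\<rfloor>, Some s) = x"
    using pt_Some_surj[of "\<lfloor>r\<rfloor>" x] by fastforce
  then show ?thesis using that by cases
qed

section \<open>Shifts of the partition\<close>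

text \<open>Meaningful on (0,1) only, because elsewhere the inverse is an arbitrary value; hence the
  tests \<open>0 < x\<close> and \<open>x < 1\<close> in \<open>act\<close> and
  \<open>slope\<close>.\<close>

definition coord :: "real \<Rightarrow> int \<times> real option" where
  "coord x = inv_into UNIV pt x"

lemma coord_pt [simp]: "coord (pt z) = z"
  by (simp add: coord_def inv_f_f inj_pt)

fun shift :: "int \<Rightarrow> (int \<Rightarrow> real) \<Rightarrow> int \<times> real option \<Rightarrow> int \<times> real option" where
  "shift n \<tau> (k, a) = (k + n, map_option (\<lambda>s. s + \<tau> k) a)"

text \<open>Extended by the identity, a shift is a bijection of the whole line, so composition and
  inversion hold without side conditions.\<close>

definition act :: "int \<Rightarrow> (int \<Rightarrow> real) \<Rightarrow> real \<Rightarrow> real" where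
  "act n \<tau> x = (if 0 < x \<and> x < 1 then pt (shift n \<tau> (coord x)) else x)"

lemma act_pt [simp]: "act n \<tau> (pt z) = pt (shift n \<tau> z)"
  by (simp add: act_def pt_in_unit)

lemma act_outside: "\<not> (0 < x \<and> x < 1) \<Longrightarrow> act n \<tau> x = x"
  by (auto simp: act_def)

lemma act_act: "act n \<tau> (act m \<sigma> x) = act (n + m) (\<lambda>k. \<sigma> k + \<tau> (k + m)) x"
proof (cases "0 < x \<and> x < 1")
  case True
  then obtain k a where "pt (k, a) = x" by (metis pt_surj surj_pair)
  then show ?thesis
    by (auto simp: option.map_comp o_def add_ac)
qed (simp add: act_outside)

lemma act_zero: "act 0 (\<lambda>_. 0) x = x"
proof (cases "0 < x \<and> x < 1")
  case True
  then obtain k a where "pt (k, a) = x" by (metis pt_surj surj_pair)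
  then show ?thesis
    by (auto simp: option.map_id0[unfolded id_def])
qed (simp add: act_outside)

lemma act_inverse:
  "act (- n) (\<lambda>k. - \<tau> (k - n)) (act n \<tau> x) = x"
  "act n \<tau> (act (- n) (\<lambda>k. - \<tau> (k - n)) x) = x"
  by (simp_all add: act_act act_zero)

lemma act_strict_mono: "strict_mono (act n \<tau>)"
proof (rule strict_monoI)
  fix x y :: real
  assume "x < y"
  have in_unit: "0 < act n \<tau> z \<and> act n \<tau> z < 1" if "0 < z \<and> z < 1" for z
    using that by (simp add: act_def pt_in_unit)
  show "act n \<tau> x < act n \<tau> y"
  proof (cases "(0 < x \<and> x < 1) \<and> (0 < y \<and> y < 1)")
    case True
    then obtain k a l b where "pt (k, a) = x" "pt (l, b) = y" by (metis pt_surj surj_pair)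
    with \<open>x < y\<close> have "pt_less (k, a) (l, b)" by (simp flip: pt_less_iff)
    then have "pt_less (shift n \<tau> (k, a)) (shift n \<tau> (l, b))"
      by (auto split: option.splits)
    then show ?thesis
      using \<open>pt (k, a) = x\<close> \<open>pt (l, b) = y\<close> pt_less_imp act_pt by metis
  next
    case False
    then show ?thesis
      using \<open>x < y\<close> in_unit[of x] in_unit[of y] act_outside[of x n \<tau>] act_outside[of y n \<tau>]
      by linarith
  qed
qed

lemma act_bij_unit: "bij_betw (act n \<tau>) {0..1} {0..1}"
proof (rule bij_betw_byWitness[where f' = "act (- n) (\<lambda>k. - \<tau> (k - n))"])
  have "act m \<sigma> ` {0..1} \<subseteq> {0..1}" for m \<sigma>
    by (auto simp: act_def less_imp_le[OF pt_in_unit(1)] less_imp_le[OF pt_in_unit(2)])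
  then show "act n \<tau> ` {0..1} \<subseteq> {0..1}" "act (- n) (\<lambda>k. - \<tau> (k - n)) ` {0..1} \<subseteq> {0..1}"
    by blast+
qed (simp_all add: act_inverse)

text \<open>A monotone surjection of the line has no jumps, so nodes and endpoints need no separate
  treatment.\<close>

lemma act_continuous: "continuous_on A (act n \<tau>)"
proof -
  have "surj (act n \<tau>)" using act_inverse(2) by (metis surjI)
  then have "continuous_on UNIV (act n \<tau>)"
    using act_strict_mono[of n \<tau>]
    by (intro continuous_onI_mono) (auto simp: strict_mono_less_eq)
  then show ?thesis by (rule continuous_on_subset) simp
qed

section \<open>The derivative of a shift and its continuity\<close>

definition slope :: "int \<Rightarrow> (int \<Rightarrow> real) \<Rightarrow> real \<Rightarrow> real" where
  "slope n \<tau> x = (case coord x of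
     (k, None) \<Rightarrow> 1
   | (k, Some s) \<Rightarrow> if 0 < x \<and> x < 1 then (rad k s / rad (k + n) (s + \<tau> k)) ^ 3 else 1)"

lemma slope_Some: "slope n \<tau> (pt (k, Some s)) = (rad k s / rad (k + n) (s + \<tau> k)) ^ 3"
  by (simp add: slope_def pt_in_unit)

text \<open>For bounded \<tau>, the default 1 is the limit of the cubed ratio at these points, so
  that \<open>slope\<close> becomes continuous on the whole line.\<close>

lemma slope_other: "\<nexists>k s. x = pt (k, Some s) \<Longrightarrow> slope n \<tau> x = 1"
  by (auto simp: slope_def split: option.splits prod.splits) (metis coord_pt pt_surj)

text \<open>One function that inverts all the branches \<open>pt (k, Some _)\<close>; its value at a
  node is arbitrary.\<close>

definition level :: "real \<Rightarrow> real" where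
  "level x = the (snd (coord x))"

lemma level_pt [simp]: "level (pt (k, Some s)) = s"
  by (simp add: level_def)

lemma interval_pt:
  assumes "y \<in> {node k<..<node (k + 1)}"
  obtains t where "y = pt (k, Some t)"
  using assms pt_Some_surj[of k y] by (metis greaterThanLessThan_iff)

text \<open>The inverse function rule applied to \<open>pt_deriv\<close>; the strong form asks for
  continuity of the parametrisation instead of continuity of \<open>level\<close>.\<close>

lemma level_deriv: "(level has_real_derivative 4 * rad k s ^ 3) (at (pt (k, Some s)))"
  unfolding has_field_derivative_def
proof (rule has_derivative_inverse_strong[where S = UNIV and f = "\<lambda>s. pt (k, Some s)"])
  show "((\<lambda>s. pt (k, Some s)) has_derivative (*) (1 / (4 * rad k s ^ 3))) (at s)"
    using pt_deriv by (simp add: has_field_derivative_def)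
  show "continuous_on UNIV (\<lambda>s. pt (k, Some s))"
    by (rule pt_continuous)
  show "(*) (1 / (4 * rad k s ^ 3)) \<circ> (*) (4 * rad k s ^ 3) = id"
    by (auto simp: fun_eq_iff)
qed auto

text \<open>Inside an interval a shift is \<open>level\<close>, then a translation, then the
  parametrisation of the target interval, so the chain rule gives a quotient of two speeds.\<close>

lemma act_deriv:
  "(act n \<tau> has_real_derivative slope n \<tau> (pt (k, Some s))) (at (pt (k, Some s)))"
proof (rule has_field_derivative_transform_within_open)
  let ?h = "\<lambda>y. pt (k + n, Some (level y + \<tau> k))"
  have "((\<lambda>u. pt (k + n, Some u)) has_real_derivative 1 / (4 * rad (k + n) (s + \<tau> k) ^ 3))
      (at (level (pt (k, Some s)) + \<tau> k))"
    using pt_deriv[of "k + n" "s + \<tau> k"] by simp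
  moreover have "((\<lambda>y. level y + \<tau> k) has_real_derivative 4 * rad k s ^ 3) (at (pt (k, Some s)))"
    using level_deriv by (auto intro!: derivative_eq_intros)
  ultimately have "(?h has_real_derivative
      1 / (4 * rad (k + n) (s + \<tau> k) ^ 3) * (4 * rad k s ^ 3)) (at (pt (k, Some s)))"
    by (rule DERIV_chain2)
  then show "(?h has_real_derivative slope n \<tau> (pt (k, Some s))) (at (pt (k, Some s)))"
    by (simp add: slope_Some power_divide)
  show "pt (k + n, Some (level y + \<tau> k)) = act n \<tau> y" if "y \<in> {node k<..<node (k + 1)}" for y
    by (rule interval_pt[OF that]) simp
  show "pt (k, Some s) \<in> {node k<..<node (k + 1)}"
    using pt_Some_bounds by simp
qed simp

lemma rad_continuous [continuous_intros]:
  "isCont f x \<Longrightarrow> isCont (\<lambda>x. rad k (f x)) x"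
  unfolding rad_def by (intro continuous_intros)

text \<open>Near a point that lies in no open interval of the partition, the radius tends to infinity,
  whereas a shift changes it only by a bounded amount.\<close>

lemma slope_continuous:
  assumes \<tau>: "\<And>k. \<bar>\<tau> k\<bar> \<le> B"
  shows "isCont (slope n \<tau>) x"
proof (cases "\<exists>k s. x = pt (k, Some s)")
  case True
  then obtain k s where x: "x = pt (k, Some s)" by blast
  let ?h = "\<lambda>y. (rad k (level y) / rad (k + n) (level y + \<tau> k)) ^ 3"
  have "\<forall>\<^sub>F y in nhds x. y \<in> {node k<..<node (k + 1)}"
    using pt_Some_bounds by (intro eventually_nhds_in_open) (auto simp: x)
  then have "\<forall>\<^sub>F y in nhds x. slope n \<tau> y = ?h y"
  proof eventually_elim
    case (elim y)
    then show ?case by (rule interval_pt) (simp add: slope_Some)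
  qed
  moreover have "isCont level x"
    using level_deriv x DERIV_isCont by blast
  then have "isCont ?h x"
    by (intro continuous_intros) auto
  ultimately show ?thesis by (simp add: isCont_cong)
next
  case False
  show ?thesis
    unfolding continuous_at tendsto_iff
  proof (intro allI impI)
    fix e :: real
    assume "e > 0"
    \<comment> \<open>The bound of \<open>rad_shift\<close> on the change of the radius.\<close>
    define M where "M = \<bar>of_int n\<bar> + 2 + B"
    have "M > 0" using \<tau>[of 0] by (simp add: M_def)
    have "isCont (\<lambda>u::real. u ^ 3) 1" by (intro continuous_intros)
    then obtain d where d: "d > 0" "\<And>u::real. \<bar>u - 1\<bar> < d \<Longrightarrow> \<bar>u ^ 3 - 1\<bar> < e"
      using \<open>e > 0\<close> unfolding continuous_at_eps_delta by (auto simp: dist_real_def)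
    \<comment> \<open>If the old radius exceeds \<open>r\<close>, the new one exceeds
      \<open>M / d\<close>, so their ratio differs from 1 by less than \<open>d\<close>.\<close>
    define r where "r = M + M / d"
    \<comment> \<open>A compact set that contains every interior point of bounded coordinates and
      misses \<open>x\<close>; near \<open>x\<close> one coordinate, hence the radius, is therefore
      large.\<close>
    define K where "K = (\<Union>k\<in>{- \<lceil>r\<rceil>..\<lceil>r\<rceil>}. (\<lambda>s. pt (k, Some s)) ` {- r..r})"
    have "compact K"
      unfolding K_def
      by (intro compact_UN compact_continuous_image pt_continuous) simp_all
    moreover have "x \<notin> K" using False by (auto simp: K_def)
    ultimately have "\<forall>\<^sub>F y in at x. y \<notin> K"
      by (metis compact_imp_closed eventually_at_topological open_Compl Compl_iff)
    then show "\<forall>\<^sub>F y in at x. dist (slope n \<tau> y) (slope n \<tau> x) < e"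
    proof eventually_elim
      case (elim y)
      show ?case
      proof (cases "\<exists>k s. y = pt (k, Some s)")
        case True
        then obtain k s where y: "y = pt (k, Some s)" by blast
        let ?R = "rad k s" and ?R' = "rad (k + n) (s + \<tau> k)"
        have "\<bar>of_int k\<bar> \<le> ?R"
        proof -
          have "\<bar>of_int k\<bar> \<le> depth k" by (rule depth_bounds)
          also have "depth k \<le> ?R"
            unfolding rad_def by (rule real_le_rsqrt) simp
          finally show ?thesis .
        qed
        moreover have "\<bar>of_int k\<bar> > r \<or> \<bar>s\<bar> > r"
        proof (rule ccontr)
          assume "\<not> ?thesis"
          then have "real_of_int k \<le> r" "- real_of_int k \<le> r" "s \<in> {- r..r}" by auto
          then have "k \<in> {- \<lceil>r\<rceil>..\<lceil>r\<rceil>}" by auto linarith+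
          with \<open>s \<in> {- r..r}\<close> have "y \<in> K" unfolding K_def y by blast
          with elim show False by simp
        qed
        ultimately have "?R > r" using abs_less_rad[of s k] by linarith
        moreover have RR: "\<bar>?R' - ?R\<bar> \<le> M"
          using rad_shift[of k n s "\<tau> k"] \<tau>[of k] by (simp add: M_def)
        ultimately have "?R' > M / d" by (simp add: r_def)
        then have "M / ?R' < d" using d(1) rad_pos[of "k + n" "s + \<tau> k"] by (simp add: field_simps)
        moreover have "\<bar>?R / ?R' - 1\<bar> = \<bar>?R' - ?R\<bar> / ?R'"
        proof -
          have "?R / ?R' - 1 = (?R - ?R') / ?R'" by (simp add: diff_divide_distrib)
          then show ?thesis
            using rad_pos[of "k + n" "s + \<tau> k"] by (simp add: abs_divide abs_minus_commute)
        qed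
        moreover have "\<bar>?R' - ?R\<bar> / ?R' \<le> M / ?R'"
          using RR rad_pos[of "k + n" "s + \<tau> k"] by (simp add: divide_right_mono)
        ultimately have "\<bar>?R / ?R' - 1\<bar> < d" by simp
        then show ?thesis
          using d(2) False by (simp add: y slope_Some slope_other dist_real_def)
      qed (use False \<open>e > 0\<close> in \<open>simp add: slope_other\<close>)
    qed
  qed
qed

text \<open>By the fundamental theorem of calculus \<open>f\<close> differs by a constant from the
  integral of \<open>g\<close>, which is differentiable at every point because \<open>g\<close> is
  continuous.\<close>

lemma has_real_derivative_finite_exceptions:
  fixes f g :: "real \<Rightarrow> real"
  assumes "finite S" "continuous_on {a..b} f" "continuous_on {a..b} g"
    and deriv: "\<And>x. x \<in> {a<..<b} - S \<Longrightarrow> (f has_real_derivative g x) (at x)"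
    and x: "x \<in> {a..b}"
  shows "(f has_real_derivative g x) (at x within {a..b})"
proof -
  have f: "f y = f a + integral {a..y} g" if "y \<in> {a..b}" for y
  proof -
    have "(g has_integral f y - f a) {a..y}"
    proof (rule fundamental_theorem_of_calculus_interior_strong[OF assms(1)])
      show "continuous_on {a..y} f" using that by (auto intro: continuous_on_subset[OF assms(2)])
    qed (use that deriv in \<open>auto simp flip: has_real_derivative_iff_has_vector_derivative\<close>)
    then show ?thesis by (simp add: integral_unique)
  qed
  have "((\<lambda>y. f a + integral {a..y} g) has_real_derivative g x) (at x within {a..b})"
    using integral_has_real_derivative[OF assms(3) x] by (auto intro!: derivative_eq_intros)
  then show ?thesis
    unfolding has_field_derivative_def by (rule has_derivative_transform[OF x f, rotated])
qed

lemma act_C1: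
  assumes \<tau>: "\<And>k. \<bar>\<tau> k\<bar> \<le> B"
  shows "C1_on_unit (act n \<tau>)"
  unfolding C1_on_unit_def
proof (intro exI[of _ "slope n \<tau>"] conjI ballI)
  have cont: "continuous_on X (slope n \<tau>)" for X
    using slope_continuous[OF \<tau>] by (simp add: continuous_at_imp_continuous_on)
  then show "continuous_on {0..1} (slope n \<tau>)" .
  have "(act n \<tau> has_real_derivative slope n \<tau> x) (at x)" if x: "x \<in> {0<..<1}" for x
  proof -
    obtain z where "pt z = x" using pt_surj[of x] x by auto
    then obtain k a where z: "x = pt (k, a)" by (cases z) auto
    \<comment> \<open>Since \<open>x\<close> may be \<open>node k\<close>, the interval reaches one
      node further left; \<open>x\<close> is then interior and \<open>node k\<close> is the only
      exception.\<close>
    let ?I = "{node (k - 1)..node (k + 1)}"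
    have "node (k - 1) < node k" by (rule iffD2[OF node_less_iff]) simp
    then have x': "node (k - 1) < x" "x < node (k + 1)"
      using pt_bounds[of k a] by (auto simp: z)
    have "(act n \<tau> has_real_derivative slope n \<tau> x) (at x within ?I)"
    proof (rule has_real_derivative_finite_exceptions[where S = "{node k}"])
      fix y
      assume "y \<in> {node (k - 1)<..<node (k + 1)} - {node k}"
      then consider "y \<in> {node (k - 1)<..<node (k - 1 + 1)}" | "y \<in> {node k<..<node (k + 1)}"
        by fastforce
      then obtain j s where "y = pt (j, Some s)"
        by cases (metis interval_pt)+
      then show "(act n \<tau> has_real_derivative slope n \<tau> y) (at y)"
        using act_deriv by simp
    qed (use x' in \<open>auto intro: act_continuous cont simp del: of_int_add\<close>)
    then show ?thesis using at_within_Icc_at[OF x'] by simp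
  qed
  \<comment> \<open>A second round is needed because infinitely many nodes accumulate at 0 and 1:
    with all of (0,1) settled, no exception remains and the endpoints are included.\<close>
  then show "(act n \<tau> has_real_derivative slope n \<tau> x) (at x within {0..1})"
    if "x \<in> {0..1}" for x
    using that
    by (intro has_real_derivative_finite_exceptions[where S = "{}"]) (auto intro: act_continuous cont)
qed

lemma C1_on_unit_cong:
  assumes "\<And>x. x \<in> {0..1} \<Longrightarrow> f x = g x" "C1_on_unit g"
  shows "C1_on_unit f"
  using assms unfolding C1_on_unit_def has_field_derivative_def
  by (metis (no_types, lifting) has_derivative_transform)

lemma act_C1_diffeo:
  assumes \<tau>: "\<And>k. \<bar>\<tau> k\<bar> \<le> B"
  shows "C1_diffeo_plus (restrict (act n \<tau>) {0..1})"
  unfolding C1_diffeo_plus_def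
proof (intro conjI)
  show bij: "bij_betw (restrict (act n \<tau>) {0..1}) {0..1} {0..1}"
    using act_bij_unit by simp
  show "strict_mono_on {0..1} (restrict (act n \<tau>) {0..1})"
    using act_strict_mono[of n \<tau>] by (auto intro!: strict_mono_onI simp: strict_mono_less)
  show "C1_on_unit (restrict (act n \<tau>) {0..1})"
    by (rule C1_on_unit_cong[OF _ act_C1[OF \<tau>]]) simp
  \<comment> \<open>The inverse is again a shift, with the same bound \<open>B\<close>.\<close>
  let ?g = "act (- n) (\<lambda>k. - \<tau> (k - n))"
  show "C1_on_unit (inv_into {0..1} (restrict (act n \<tau>) {0..1}))"
  proof (rule C1_on_unit_cong)
    fix y :: real
    assume "y \<in> {0..1}"
    then have "?g y \<in> {0..1}"
      using act_bij_unit by (meson bij_betwE)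
    then show "inv_into {0..1} (restrict (act n \<tau>) {0..1}) y = ?g y"
      using bij by (intro inv_into_f_eq) (auto simp: act_inverse bij_betw_def)
  next
    show "C1_on_unit ?g" using \<tau> by (intro act_C1) simp
  qed
qed

section \<open>The action of the semidirect product\<close>

text \<open>\<open>M - mat c\<close> is singular, hence so is its transpose, and a kernel vector of
  the transpose is a left eigenvector of \<open>M\<close>.\<close>

lemma left_eigenvector:
  fixes M :: "'a::field ^ 'n ^ 'n"
  assumes "matrix_eigenvalue M c"
  obtains w where "w \<noteq> 0" "w v* M = c *s w"
proof -
  let ?N = "M - mat c"
  have mat: "mat c *v x = c *s x" for x :: "'a ^ 'n"
    by (simp add: vec_eq_iff matrix_vector_mult_def mat_def if_distrib if_distribR sum.delta'
        cong: if_cong)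
  obtain v where "v \<noteq> 0" "M *v v = c *s v"
    using assms unfolding matrix_eigenvalue_def by blast
  then have "\<not> (\<forall>x. ?N *v x = 0 \<longrightarrow> x = 0)"
    by (metis mat matrix_vector_mult_diff_rdistrib right_minus_eq)
  then have "\<nexists>B. B ** ?N = mat 1" by (simp add: matrix_left_invertible_ker)
  then have "\<nexists>B. B ** transpose ?N = mat 1"
    by (metis matrix_left_right_inverse matrix_transpose_mul transpose_mat transpose_transpose)
  then obtain w where w: "w \<noteq> 0" "transpose ?N *v w = 0"
    by (auto simp only: matrix_left_invertible_ker)
  have "transpose ?N = transpose M - mat c"
    by (auto simp: vec_eq_iff transpose_def mat_def)
  then have "transpose M *v w = c *s w"
    using w(2) by (metis mat matrix_vector_mult_diff_rdistrib right_minus_eq)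
  then show ?thesis using w(1) that by simp
qed

lemma eigen_functional:
  fixes A :: "rat ^ 'n ^ 'n" and c :: complex
  assumes "matrix_eigenvalue (map_matrix of_rat A) c"
  obtains f :: "rat ^ 'n \<Rightarrow> complex"
  where "\<And>v w. f (v + w) = f v + f w" "\<And>r v. f (r *s v) = of_rat r * f v"
    "\<And>v. f (A *v v) = c * f v" "\<exists>v. Re (f v) \<noteq> 0"
proof -
  obtain w :: "complex ^ 'n" where w: "w \<noteq> 0" "w v* map_matrix of_rat A = c *s w"
    using left_eigenvector[OF assms] .
  have wA: "(\<Sum>i\<in>UNIV. w $ i * of_rat (A $ i $ j)) = c * w $ j" for j
    using w(2) by (simp add: vec_eq_iff vector_matrix_mult_def map_matrix_def mult.commute)
  obtain i where i: "w $ i \<noteq> 0" using w(1) by (auto simp: vec_eq_iff)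
  \<comment> \<open>The factor \<open>cnj (w $ i)\<close> makes the value at the \<open>i\<close>-th
    basis vector the positive real |w_i|^2, so that the real part, which alone enters the action,
    does not vanish identically.\<close>
  define f where "f v = cnj (w $ i) * (\<Sum>j\<in>UNIV. w $ j * of_rat (v $ j))" for v :: "rat ^ 'n"
  show ?thesis
  proof
    show "f (v + u) = f v + f u" for v u
      by (simp add: f_def of_rat_add distrib_left sum.distrib)
    show "f (r *s v) = of_rat r * f v" for r v
      by (simp add: f_def of_rat_mult sum_distrib_left algebra_simps)
    show "f (A *v v) = c * f v" for v
    proof -
      have "(\<Sum>j\<in>UNIV. w $ j * of_rat ((A *v v) $ j))
          = (\<Sum>j\<in>UNIV. \<Sum>k\<in>UNIV. w $ j * of_rat (A $ j $ k) * of_rat (v $ k))"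
        by (simp add: matrix_vector_mult_def of_rat_sum of_rat_mult sum_distrib_left mult.assoc)
      also have "\<dots> = (\<Sum>k\<in>UNIV. (\<Sum>j\<in>UNIV. w $ j * of_rat (A $ j $ k)) * of_rat (v $ k))"
        by (subst sum.swap) (simp add: sum_distrib_right)
      also have "\<dots> = c * (\<Sum>k\<in>UNIV. w $ k * of_rat (v $ k))"
        by (simp add: wA sum_distrib_left mult.assoc)
      finally show ?thesis by (simp add: f_def)
    qed
    have "f (axis i 1) = cnj (w $ i) * w $ i"
      by (simp add: f_def axis_def if_distrib cong: if_cong)
    then have "Re (f (axis i 1)) = (cmod (w $ i))\<^sup>2"
      by (simp add: cmod_power2) (simp add: power2_eq_square)
    then show "\<exists>v. Re (f v) \<noteq> 0" using i by (intro exI[of _ "axis i 1"]) simp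
  qed
qed

section \<open>Translation lengths of vectors and the resulting action\<close>

locale unit_eigen_functional =
  fixes A :: "rat ^ 'n ^ 'n" and c :: complex and f :: "rat ^ 'n \<Rightarrow> complex"
  assumes invertible: "invertible A" and irreducible: "Q_irreducible A"
    and c: "cmod c = 1"
    and f_add: "f (v + w) = f v + f w"
    and f_scale: "f (r *s v) = of_rat r * f v"
    and f_eigen: "f (A *v v) = c * f v"
    and f_nonzero: "\<exists>v. Re (f v) \<noteq> 0"
begin

lemma c_nonzero: "c \<noteq> 0"
  using c by auto

lemma f_mat_int_act: "f (mat_int_act A k v) = c powi k * f v"
proof (induction k rule: int_induct[where k = 0])
  case (step1 i)
  then show ?case
    by (simp add: mat_int_act_Suc[OF invertible] f_eigen power_int_add c_nonzero)
next
  case (step2 i)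
  have "A *v (matrix_inv A *v u) = u" for u
    by (simp add: matrix_vector_mul_assoc matrix_inv_both[OF invertible])
  then have "c * f (mat_int_act A (i - 1) v) = f (mat_int_act A i v)"
    by (simp add: mat_int_act_pred[OF invertible] flip: f_eigen)
  then have "c * f (mat_int_act A (i - 1) v) = c * (c powi (i - 1) * f v)"
    using step2 by (simp add: power_int_diff c_nonzero)
  then show ?case using c_nonzero by simp
qed simp

text \<open>On interval \<open>k\<close>, \<open>v\<close> must act as
  \<open>a^(-k) v a^k = A^(-k) v\<close> does on interval 0, and \<open>f\<close> turns
  \<open>A^(-k)\<close> into the factor \<open>c^(-k)\<close>.\<close>

definition time :: "rat ^ 'n \<Rightarrow> int \<Rightarrow> real" where
  "time v k = Re (c powi (- k) * f v)"

lemma time_add: "time (v + w) k = time v k + time w k"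
  by (simp add: time_def f_add distrib_left)

lemma time_scale: "time (r *s v) k = of_rat r * time v k"
proof -
  have "complex_of_real (of_rat r) = of_rat r" by (cases r) (simp add: of_rat_rat)
  moreover have Re: "Re (of_real a * z) = a * Re z" for a z by simp
  ultimately have "c powi (- k) * f (r *s v) = of_real (of_rat r) * (c powi (- k) * f v)"
    by (simp add: f_scale)
  then show ?thesis by (simp only: time_def Re)
qed

lemma time_mat_int_act: "time (mat_int_act A j v) k = time v (k - j)"
proof -
  have "c powi (- k) * c powi j = c powi (- (k - j))"
    by (simp add: c_nonzero flip: power_int_add)
  then show ?thesis by (simp only: time_def f_mat_int_act flip: mult.assoc)
qed

text \<open>Powers of \<open>c\<close> have modulus 1, so the bound is uniform in \<open>k\<close>,
  as \<open>act_C1\<close> requires.\<close>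

lemma time_bounded: "\<bar>time v k\<bar> \<le> cmod (f v)"
proof -
  have "\<bar>time v k\<bar> \<le> cmod (c powi (- k) * f v)" unfolding time_def by (rule abs_Re_le_cmod)
  then show ?thesis by (simp add: norm_mult norm_power_int c)
qed

text \<open>The vectors that translate no interval form an \<open>A\<close>-invariant rational
  subspace, which is proper because the real part of \<open>f\<close> is not identically zero;
  irreducibility makes it trivial.\<close>

lemma time_eq_zero_imp:
  assumes "\<And>k. time v k = 0"
  shows "v = 0"
proof -
  let ?S = "{u. \<forall>k. time u k = 0}"
  have "time 0 k = 0" for k using time_add[of 0 0 k] by simp
  then have "vec.subspace ?S"
    by (auto simp: vec.subspace_def time_add time_scale)
  moreover have "time (A *v u) k = time u (k - 1)" for u k
    using time_mat_int_act[of 1 u k] by simp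
  then have "(*v) A ` ?S \<subseteq> ?S" by auto
  ultimately have "?S = {0} \<or> ?S = UNIV"
    using irreducible unfolding Q_irreducible_def by blast
  moreover have "?S \<noteq> UNIV"
  proof -
    obtain u where "time u 0 \<noteq> 0" using f_nonzero by (auto simp: time_def)
    then show ?thesis by auto
  qed
  ultimately show ?thesis using assms by blast
qed

text \<open>In \<open>v a^n\<close> the power of \<open>a\<close> acts first, so \<open>v\<close>
  translates on the target interval \<open>k + n\<close>, whereas \<open>act\<close> indexes by the
  source. The restriction yields extensional maps, as \<open>BijGroup\<close> demands.\<close>

definition \<rho> :: "int \<times> (rat ^ 'n) \<Rightarrow> real \<Rightarrow> real" where
  "\<rho> g = restrict (act (fst g) (\<lambda>k. time (snd g) (k + fst g))) {0..1}"

lemma rho_pt: "\<rho> (n, v) (pt (k, a)) = pt (k + n, map_option (\<lambda>s. s + time v (k + n)) a)"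
  using pt_in_unit[of "(k, a)"] by (simp add: \<rho>_def less_imp_le)

lemma rho_Bij: "\<rho> g \<in> Bij {0..1}"
  using act_bij_unit by (simp add: \<rho>_def Bij_def)

lemma rho_mult: "\<rho> (g \<otimes>\<^bsub>Z_semidirect A\<^esub> h) = compose {0..1} (\<rho> g) (\<rho> h)"
proof (rule ext)
  fix x
  obtain n v m w where gh: "g = (n, v)" "h = (m, w)" by (metis surj_pair)
  have "act m \<sigma> x \<in> {0..1}" if "x \<in> {0..1}" for m \<sigma>
    using that act_bij_unit by (meson bij_betwE)
  then show "\<rho> (g \<otimes>\<^bsub>Z_semidirect A\<^esub> h) x = compose {0..1} (\<rho> g) (\<rho> h) x"
    by (simp add: gh \<rho>_def compose_def act_act Z_semidirect_def time_add time_mat_int_act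
        algebra_simps)
qed

text \<open>The nodes reveal the power of the generator, the points \<open>Some 0\<close> then all
  translation lengths, and these determine the vector.\<close>

lemma rho_inj: "inj \<rho>"
proof (rule injI)
  fix g h
  assume eq: "\<rho> g = \<rho> h"
  obtain n v m w where gh: "g = (n, v)" "h = (m, w)" by (metis surj_pair)
  have pt: "pt (k + n, map_option (\<lambda>s. s + time v (k + n)) a)
      = pt (k + m, map_option (\<lambda>s. s + time w (k + m)) a)" for k a
    using eq by (simp add: gh flip: rho_pt)
  have "n = m" using pt[of 0 None] by simp
  have "time v k = time w k" for k
    using pt[of "k - n" "Some 0"] \<open>n = m\<close> by (simp add: inj_eq[OF inj_pt])
  then have "time (v - w) k = 0" for k
    using time_add[of "v - w" w k] by simp
  then have "v - w = 0" by (rule time_eq_zero_imp)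
  then show "g = h" using \<open>n = m\<close> by (simp add: gh)
qed

lemma rho_faithful: "faithful_action (Z_semidirect A) {0..1} \<rho>"
proof -
  have "\<rho> \<in> hom (Z_semidirect A) (BijGroup {0..1})"
    by (rule homI) (simp_all add: rho_Bij rho_mult BijGroup_def)
  then have "group_hom (Z_semidirect A) (BijGroup {0..1}) \<rho>"
    by (simp add: group_hom_def group_hom_axioms_def group_BijGroup group_Z_semidirect invertible)
  moreover have "inj_on \<rho> (carrier (Z_semidirect A))"
    using rho_inj by (rule inj_on_subset) simp
  ultimately show ?thesis
    by (simp add: faithful_action_def faithful_action_axioms_def group_action_def)
qed

lemma rho_C1_diffeo: "C1_diffeo_plus (\<rho> g)"
  unfolding \<rho>_def by (rule act_C1_diffeo) (rule time_bounded)

lemma rho_no_fixed_point: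
  assumes "x \<in> {0<..<1}"
  shows "\<not> global_fixed_point (Z_semidirect A) \<rho> x"
proof
  assume "global_fixed_point (Z_semidirect A) \<rho> x"
  then have fixed: "\<rho> (1, 0) x = x"
    by (simp add: global_fixed_point_def Z_semidirect_def)
  obtain z where "pt z = x" using assms pt_surj[of x] by auto
  moreover obtain k a where "z = (k, a)" by fastforce
  ultimately show False
    using fixed by (auto simp: rho_pt inj_eq[OF inj_pt])
qed

text \<open>A vector fixes every node, so if \<open>F\<close> separated two consecutive nodes, its
  affine image would be trivial and \<open>F\<close> would be constant along the orbits, which accumulate at both
  nodes.\<close>

lemma rho_not_affine: "\<not> semiconjugate_to_affine (Z_semidirect A) \<rho>"
proof
  assume "semiconjugate_to_affine (Z_semidirect A) \<rho>"
  then obtain \<psi> and F :: "real \<Rightarrow> real" where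
    \<psi>: "\<psi> \<in> hom (Z_semidirect A) Aff_plus"
    and F: "continuous_on {0<..<1} F" "mono_on {0<..<1} F" "F ` {0<..<1} = UNIV"
    and equiv: "\<And>g x. x \<in> {0<..<1} \<Longrightarrow> F (\<rho> g x) = \<psi> g (F x)"
    unfolding semiconjugate_to_affine_def by (auto simp: Z_semidirect_def)
  have unit: "pt z \<in> {0<..<1}" for z using pt_in_unit by simp
  have nodes: "F (node j) = F (node (j + 1))" for j
  proof (rule ccontr)
    assume ne: "F (node j) \<noteq> F (node (j + 1))"
    \<comment> \<open>An affine map with two distinct fixed points is the identity.\<close>
    have trivial: "\<psi> (0, u) y = y" for u y
    proof -
      obtain a b where ab: "\<psi> (0, u) = (\<lambda>x. a * x + b)"
        using hom_in_carrier[OF \<psi>, of "(0, u)"] by (auto simp: Aff_plus_def Z_semidirect_def)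
      have fixed: "\<psi> (0, u) (F (node k)) = F (node k)" for k
        using equiv[OF unit[of "(k, None)"], of "(0, u)"] rho_pt[of 0 u k None] by simp
      have "(a - 1) * (F (node j) - F (node (j + 1))) = 0"
        using fixed[of j] fixed[of "j + 1"] unfolding ab by (simp add: algebra_simps)
      then have "a = 1" using ne by simp
      then show ?thesis using fixed[of j] by (simp add: ab)
    qed
    obtain v0 where v0: "Re (f v0) \<noteq> 0" using f_nonzero by blast
    define s where "s = Re (f v0)"
    \<comment> \<open>Applying \<open>A^j\<close> cancels the factor \<open>c^(-j)\<close>, so
      \<open>v\<close> translates interval \<open>j\<close> by exactly \<open>s\<close>.\<close>
    define v where "v = mat_int_act A j v0"
    have v: "time (r *s v) j = of_rat r * s" for r
      unfolding time_scale by (simp add: v_def time_mat_int_act) (simp add: time_def s_def)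
    have orbit: "F (pt (j, Some (of_int m * s))) = F (pt (j, Some 0))" for m :: int
      using equiv[OF unit[of "(j, Some 0)"], of "(0, of_int m *s v)"]
      by (simp add: rho_pt v trivial)
    \<comment> \<open>This sign makes positive multiples move to the right even if \<open>s\<close>
      is negative.\<close>
    define \<sigma> :: int where "\<sigma> = (if s > 0 then 1 else - 1)"
    have lim: "F (pt (j, Some 0)) = F x"
      if lim: "(\<lambda>m. pt (j, Some (of_int (i m) * s))) \<longlonglongrightarrow> x" and x: "x \<in> {0<..<1}"
      for i :: "nat \<Rightarrow> int" and x
    proof -
      have "isCont F x" using F(1) x by (simp add: continuous_on_eq_continuous_at)
      then have "(\<lambda>m. F (pt (j, Some (of_int (i m) * s)))) \<longlonglongrightarrow> F x"
        using lim by (rule isCont_tendsto_compose)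
      then show ?thesis by (simp only: orbit LIMSEQ_const_iff)
    qed
    have \<sigma>: "of_int \<sigma> * s = \<bar>s\<bar>" using v0 by (auto simp: \<sigma>_def)
    have "filterlim (\<lambda>m. real m * \<bar>s\<bar>) at_top sequentially"
      using v0
      by (intro filterlim_at_top_mult_tendsto_pos[where c = "\<bar>s\<bar>"] filterlim_real_sequentially
          tendsto_const) (simp add: s_def)
    then have top: "filterlim (\<lambda>m. of_int (\<sigma> * int m) * s) at_top sequentially"
      by (simp add: mult_ac flip: \<sigma>)
    then have "F (pt (j, Some 0)) = F (node (j + 1))"
      using unit[of "(j + 1, None)"]
      by (intro lim[of "\<lambda>m. \<sigma> * int m"] filterlim_compose[OF pt_tendsto_top]) auto
    moreover have "filterlim (\<lambda>m. of_int (- (\<sigma> * int m)) * s) at_bot sequentially"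
      using top by (simp add: filterlim_uminus_at_bot)
    then have "F (pt (j, Some 0)) = F (node j)"
      using unit[of "(j, None)"]
      by (intro lim[of "\<lambda>m. - (\<sigma> * int m)"] filterlim_compose[OF pt_tendsto_bot]) auto
    ultimately show False using ne by simp
  qed
  have const: "F (node j) = F (node 0)" for j
  proof (induction j rule: int_induct[where k = 0])
    case (step2 i)
    then show ?case using nodes[of "i - 1"] by simp
  qed (use nodes in simp_all)
  \<comment> \<open>Some node lies to the right of any given point, so the common value of
    \<open>F\<close> at the nodes bounds \<open>F\<close> from above, against surjectivity.\<close>
  obtain x where x: "x \<in> {0<..<1}" "F x = F (node 0) + 1"
    using F(3) by (metis UNIV_I imageE)
  obtain z where z: "pt z = x" using x(1) pt_surj[of x] by auto
  obtain k a where "z = (k, a)" by fastforce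
  then have "x < node (k + 1)" using z pt_bounds(2) by blast
  then have "F x \<le> F (node (k + 1))"
    using F(2) x(1) unit[of "(k + 1, None)"] by (auto simp: monotone_on_def)
  then show False using const[of "k + 1"] x(2) by simp
qed

end

theorem theorem1p9:
  fixes A :: "rat ^ 'n ^ 'n"
  assumes "invertible A"
    and "non_hyperbolic A"
    and "Q_irreducible A"
  shows "\<exists>\<rho> :: int \<times> (rat ^ 'n) \<Rightarrow> real \<Rightarrow> real.
           faithful_action (Z_semidirect A) {0..1} \<rho> \<and>
           (\<forall>g\<in>carrier (Z_semidirect A). C1_diffeo_plus (\<rho> g)) \<and>
           \<not> semiconjugate_to_affine (Z_semidirect A) \<rho> \<and>
           \<not> (\<exists>x\<in>{0<..<1}. global_fixed_point (Z_semidirect A) \<rho> x)"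
proof -
  obtain c :: complex where c: "matrix_eigenvalue (map_matrix of_rat A) c" "cmod c = 1"
    using assms(2) unfolding non_hyperbolic_def by blast
  obtain f :: "rat ^ 'n \<Rightarrow> complex"
    where "\<And>v w. f (v + w) = f v + f w" "\<And>r v. f (r *s v) = of_rat r * f v"
      "\<And>v. f (A *v v) = c * f v" "\<exists>v. Re (f v) \<noteq> 0"
    using eigen_functional[OF c(1)] by blast
  then interpret unit_eigen_functional A c f
    using assms c(2) by unfold_locales
  show ?thesis
    using rho_faithful rho_C1_diffeo rho_not_affine rho_no_fixed_point by blast
qed

end
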